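(* Let $G$ be a locally compact group which satisfies property RD with respect to a length $\ell$ with exponent $s$. Let $\alpha\in\operatorname{Aut}(G)$. Then for every nonempty relatively compact open set $U\subseteq G$ there exists $D>0$ such that $$\Delta_G(\alpha)^{n}\le D\bigl(1+\ell(\alpha^{-n}(U))\bigr)^{2s}$$ for all $n\in\mathbb{Z}$.
   Context: Locally compact groups are endowed with right-invariant Haar measures. $\operatorname{Aut}(G)$ is the group of all topological automorphisms of $G$. If $\rho$ is a right Haar measure on $G$, the modular homomorphism $\Delta_G\colon\operatorname{Aut}(G)\to\mathbb{R}_+$ is defined by $\alpha_*\rho=\Delta_G(\alpha)\rho$, where $\alpha_*\rho$ is the push-forward measure. A length on $G$ is a Borel function $\ell\colon G\to[0,\infty)$ with $\ell(1)=0$, $\ell(x^{-1})=\ell(x)$ and $\ell(xy)\le \ell(x)+\ell(y)$ for all $x,y\in G$. For $U\subseteq G$ put $\ell(U)=\sup\{\ell(x):x\in U\}$, and for a function $f$ on $G$ put $\ell(f)=\sup\{\ell(x):f(x)\ne 0\}$. For $f\in C_c(G)$ (compactly supported continuous functions), let $T_f$ be the left convolution operator on $L^2(G)$ given by $T_fg(x)=\int_G f(y^{-1})g(yx)\,dy$ (right Haar measure), and let $\|f\|_{op}$ be its operator norm. The group $G$ satisfies property RD with respect to $\ell$ with exponent $s>0$ if there exists a constant $C>0$ such that $\|f\|_{op}\le C(1+\ell(f))^s\|f\|_2$ for every $f\in C_c(G)$. *)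

theory Defs
  imports "HOL-Analysis.Analysis"
begin

text \<open>
  Groups are written additively because the library's class of topological groups,
  \<^class>\<open>topological_group_add\<close>, is additive; it does not assume commutativity.
  Thus \<open>x + y\<close>, \<open>- x\<close> and \<open>0\<close> stand for the product, the inverse and the unit, and
  the order of summands matters. As usual, locally compact groups are Hausdorff. No
  countability or metrizability assumption is made.
\<close>

text \<open>
  A right Haar measure is a nonzero right-invariant Radon measure on the Borel sets:
  finite on compact sets, outer regular on Borel sets and inner regular on open sets.
\<close>

definition right_haar_measure :: "'a::{topological_group_add,t2_space} measure \<Rightarrow> bool" where
  "right_haar_measure \<rho> \<longleftrightarrow>
     sets \<rho> = sets borel \<and>
     (\<forall>K. compact K \<longrightarrow> emeasure \<rho> K < \<infinity>) \<and>
     (\<forall>A\<in>sets borel. emeasure \<rho> A = (INF V\<in>{V. open V \<and> A \<subseteq> V}. emeasure \<rho> V)) \<and>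
     (\<forall>V. open V \<longrightarrow> emeasure \<rho> V = (SUP K\<in>{K. compact K \<and> K \<subseteq> V}. emeasure \<rho> K)) \<and>
     emeasure \<rho> UNIV \<noteq> 0 \<and>
     (\<forall>x. distr \<rho> borel (\<lambda>y. y + x) = \<rho>)"

definition top_automorphism :: "('a::topological_group_add \<Rightarrow> 'a) \<Rightarrow> bool" where
  "top_automorphism \<alpha> \<longleftrightarrow>
     homeomorphic_map euclidean euclidean \<alpha> \<and> (\<forall>x y. \<alpha> (x + y) = \<alpha> x + \<alpha> y)"

definition aut_power :: "('a \<Rightarrow> 'a) \<Rightarrow> int \<Rightarrow> 'a \<Rightarrow> 'a" where
  "aut_power \<alpha> n = (if 0 \<le> n then \<alpha> ^^ nat n else inv \<alpha> ^^ nat (- n))"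

text \<open>
  The value does not depend on the choice of the right Haar measure \<open>\<rho>\<close>; existence and
  uniqueness of \<open>c\<close> for a topological automorphism rest on the uniqueness of Haar
  measure up to scaling.
\<close>

definition modular_hom ::
    "'a::{topological_group_add,t2_space} measure \<Rightarrow> ('a \<Rightarrow> 'a) \<Rightarrow> real" where
  "modular_hom \<rho> \<alpha> = (THE c. 0 < c \<and> distr \<rho> borel \<alpha> = scale_measure (ennreal c) \<rho>)"

definition group_length :: "('a::topological_group_add \<Rightarrow> real) \<Rightarrow> bool" where
  "group_length l \<longleftrightarrow>
     l \<in> borel_measurable borel \<and>
     (\<forall>x. 0 \<le> l x) \<and>
     l 0 = 0 \<and>
     (\<forall>x. l (- x) = l x) \<and>
     (\<forall>x y. l (x + y) \<le> l x + l y)"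

text \<open>
  Suprema of lengths are taken in \<open>[0, \<infinity>]\<close>, since \<^const>\<open>Sup\<close> on the reals is
  unspecified on unbounded sets and on the empty set (here the supremum over the empty
  set is \<open>0\<close>).
\<close>

definition set_length :: "('a \<Rightarrow> real) \<Rightarrow> 'a set \<Rightarrow> ennreal" where
  "set_length l U = (SUP x\<in>U. ennreal (l x))"

definition fun_length :: "('a \<Rightarrow> real) \<Rightarrow> ('a \<Rightarrow> complex) \<Rightarrow> ennreal" where
  "fun_length l f = set_length l {x. f x \<noteq> 0}"

text \<open>Real powers on \<open>[0, \<infinity>]\<close>, only used with exponent \<open>s > 0\<close>.\<close>

definition ennreal_powr :: "ennreal \<Rightarrow> real \<Rightarrow> ennreal" where
  "ennreal_powr x s = (if x = \<infinity> then \<infinity> else ennreal (enn2real x powr s))"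

definition compactly_supported_continuous :: "('a::topological_space \<Rightarrow> complex) \<Rightarrow> bool" where
  "compactly_supported_continuous f \<longleftrightarrow>
     continuous_on UNIV f \<and> compact (closure {x. f x \<noteq> 0})"

text \<open>
  Elements of \<open>L\<^sup>2\<close> are represented by Borel functions \<open>g\<close> with \<open>L2_norm \<rho> g < \<infinity>\<close>.
\<close>

definition L2_norm :: "'a measure \<Rightarrow> ('a \<Rightarrow> complex) \<Rightarrow> ennreal" where
  "L2_norm \<rho> g = ennreal_powr (\<integral>\<^sup>+x. ennreal ((cmod (g x))\<^sup>2) \<partial>\<rho>) (1/2)"

definition conv_operator ::
    "'a::topological_group_add measure \<Rightarrow> ('a \<Rightarrow> complex) \<Rightarrow> ('a \<Rightarrow> complex) \<Rightarrow> 'a \<Rightarrow> complex" where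
  "conv_operator \<rho> f g = (\<lambda>x. \<integral>y. f (- y) * g (y + x) \<partial>\<rho>)"

definition op_norm :: "'a::topological_group_add measure \<Rightarrow> ('a \<Rightarrow> complex) \<Rightarrow> ennreal" where
  "op_norm \<rho> f =
     (SUP g\<in>{g. g \<in> borel_measurable borel \<and> L2_norm \<rho> g \<le> 1}. L2_norm \<rho> (conv_operator \<rho> f g))"

definition property_RD ::
    "'a::topological_group_add measure \<Rightarrow> ('a \<Rightarrow> real) \<Rightarrow> real \<Rightarrow> bool" where
  "property_RD \<rho> l s \<longleftrightarrow>
     0 < s \<and>
     (\<exists>C::real. 0 < C \<and>
       (\<forall>f. compactly_supported_continuous f \<longrightarrow>
          op_norm \<rho> f \<le> ennreal C * ennreal_powr (1 + fun_length l f) s * L2_norm \<rho> f))"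

end

theory Submission
  imports Defs
begin

text \<open>
  Let \<open>\<Delta>\<close> be the modular constant of \<open>\<alpha>\<close>, that is \<open>\<alpha>\<^sub>*\<rho> = \<Delta> \<rho>\<close>, and put \<open>\<beta> = \<alpha>\<^sup>n\<close> and
  \<open>d = \<Delta>\<^sup>n\<close>, so that \<open>\<beta>\<^sub>*\<rho> = d \<rho>\<close>. The change of variables \<open>y \<mapsto> \<beta> y\<close> multiplies squared
  \<open>L\<^sup>2\<close> norms by \<open>d\<close>, and it turns the convolution of \<open>f \<circ> \<beta>\<close> with \<open>g \<circ> \<beta>\<close> into
  \<open>d (T\<^sub>f g) \<circ> \<beta>\<close>. Hence the operator norm of \<open>f \<circ> \<beta>\<close> is \<open>d\<close> times that of \<open>f\<close>, whereas its
  \<open>L\<^sup>2\<close> norm only grows by the factor \<open>d\<^sup>1\<^sup>/\<^sup>2\<close>. If \<open>f\<close> is supported in \<open>U\<close>, then \<open>f \<circ> \<beta>\<close> is supported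
  in \<open>\<beta>\<^sup>-\<^sup>1(U)\<close>, and property RD applied to \<open>f \<circ> \<beta>\<close> bounds \<open>d\<^sup>1\<^sup>/\<^sup>2\<close> by a constant times
  \<open>(1 + l(\<beta>\<^sup>-\<^sup>1(U)))\<^sup>s\<close>. The constant depends on \<open>f\<close> only, provided that \<open>T\<^sub>f \<noteq> 0\<close>; for a
  nonnegative \<open>f \<noteq> 0\<close> the function \<open>T\<^sub>f f\<close> is continuous, nonnegative and nonzero, so \<open>f\<close> itself
  serves as the test vector. This is \<open>modulus_le_of_property_RD\<close>.

  The existence of the constant \<open>\<Delta>\<close> is the uniqueness of Haar measure up to scaling, applied to
  \<open>\<rho>\<close> and its push-forward (\<open>Haar_measure_unique\<close>). For right Haar measures \<open>\<mu>\<close>, \<open>\<nu>\<close> and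
  functions \<open>f\<close>, \<open>g\<close> in \<open>C\<^sub>c\<close>, two applications of Fubini's theorem and the invariance of both
  measures give, in additive notation,
  \<open>\<integral> g(-s) (\<integral> f(s + t) d\<nu>(t)) d\<mu>(s) = (\<integral> f d\<mu>) (\<integral> g d\<nu>)\<close>. Since \<open>g\<close> is
  arbitrary, the continuous function \<open>s \<mapsto> \<integral> f(s + t) d\<nu>(t)\<close>, divided by \<open>\<integral> f d\<mu>\<close> when that is
  nonzero, does not depend on \<open>f\<close>. Its value at \<open>0\<close> is the ratio of the two integrals of \<open>f\<close>, so the integrals are
  proportional on \<open>C\<^sub>c\<close>; by Urysohn's lemma and regularity the measures are proportional.

  The group need not be second countable, so the product of the Borel \<open>\<sigma>\<close>-algebras can be smaller
  than the Borel \<open>\<sigma>\<close>-algebra of the product, and \<open>\<rho>\<close> need not be \<open>\<sigma>\<close>-finite. Fubini's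
  theorem is therefore proved directly for continuous functions of compact support (\<open>Fubini_Cc\<close>).
\<close>

section \<open>Integration of compactly supported continuous functions\<close>

text \<open>
  The space \<open>C\<^sub>c\<close> of real-valued continuous functions of compact support. The support is only
  required to lie in some compact set.
\<close>

definition Cc :: "('a::topological_space \<Rightarrow> real) \<Rightarrow> bool" where
  "Cc f \<longleftrightarrow> continuous_on UNIV f \<and> (\<exists>K. compact K \<and> (\<forall>x. x \<notin> K \<longrightarrow> f x = 0))"

lemma CcI:
  assumes "continuous_on UNIV f" "compact K" "\<And>x. x \<notin> K \<Longrightarrow> f x = 0"
  shows "Cc f"
  using assms by (auto simp: Cc_def)

lemma Cc_continuous: "Cc f \<Longrightarrow> continuous_on UNIV f"
  by (simp add: Cc_def)

lemma Cc_measurable: "Cc f \<Longrightarrow> f \<in> borel_measurable borel"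
  by (simp add: Cc_continuous borel_measurable_continuous_onI)

lemma finite_borel_partition:
  assumes "finite D" "\<And>d. d \<in> D \<Longrightarrow> X d \<in> sets M"
  shows "\<exists>P. (\<forall>d\<in>D. P d \<in> sets M \<and> P d \<subseteq> X d) \<and> disjoint_family_on P D \<and>
           (\<Union>d\<in>D. P d) = (\<Union>d\<in>D. X d)"
  using assms
proof (induction D rule: finite_induct)
  case empty
  then show ?case by (auto simp: disjoint_family_on_def)
next
  case (insert a D)
  then obtain P where P: "\<forall>d\<in>D. P d \<in> sets M \<and> P d \<subseteq> X d" "disjoint_family_on P D"
    "(\<Union>d\<in>D. P d) = (\<Union>d\<in>D. X d)"
    by auto
  let ?Q = "P(a := X a - (\<Union>d\<in>D. P d))"
  have "(\<Union>d\<in>D. P d) \<in> sets M"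
    using P(1) insert.hyps by auto
  then have "\<forall>d\<in>insert a D. ?Q d \<in> sets M \<and> ?Q d \<subseteq> X d"
    using P(1) insert by auto
  moreover have "disjoint_family_on ?Q (insert a D)"
    using P(2) insert.hyps by (fastforce simp: disjoint_family_on_def)
  moreover have "(\<Union>d\<in>insert a D. ?Q d) = (\<Union>d\<in>insert a D. X d)"
  proof -
    have "(\<Union>d\<in>D. ?Q d) = (\<Union>d\<in>D. P d)"
      using insert.hyps by (intro SUP_cong) auto
    then show ?thesis
      using P(3) by auto
  qed
  ultimately show ?case
    by (intro exI[of _ ?Q] conjI)
qed

lemma continuous_slice:
  fixes h :: "'b::topological_space \<Rightarrow> 'c::topological_space \<Rightarrow> real"
  assumes "continuous_on UNIV (\<lambda>(x, y). h x y)"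
  shows "continuous_on UNIV (h x)" and "continuous_on UNIV (\<lambda>x. h x y)"
proof -
  have "continuous_on UNIV (\<lambda>y. (x, y))" "continuous_on UNIV (\<lambda>x. (x, y))"
    by (intro continuous_intros)+
  from this[THEN continuous_on_compose2[OF assms]]
  show "continuous_on UNIV (h x)" and "continuous_on UNIV (\<lambda>x. h x y)"
    by simp_all
qed

text \<open>Near \<open>x\<close>, the slices of a jointly continuous function are uniformly close on a compact set.\<close>

lemma uniformly_close_on_compact:
  fixes h :: "'b::topological_space \<Rightarrow> 'c::topological_space \<Rightarrow> real"
  assumes "continuous_on UNIV (\<lambda>(x, y). h x y)" "compact L" "0 < e"
  shows "\<exists>X. x \<in> X \<and> open X \<and> (\<forall>x'\<in>X. \<forall>y\<in>L. \<bar>h x' y - h x y\<bar> \<le> e)"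
proof -
  have "continuous_on (UNIV \<times> L) (\<lambda>(x, y). h x y)"
    by (rule continuous_on_subset[OF assms(1)]) auto
  then obtain X where "x \<in> X" "open X"
    "\<forall>x'\<in>X \<inter> UNIV. \<forall>y\<in>L. dist ((\<lambda>(x, y). h x y) (x', y)) ((\<lambda>(x, y). h x y) (x, y)) \<le> e"
    by (rule continuous_on_prod_compactE[OF _ assms(2) UNIV_I[of x] assms(3)])
  then show ?thesis
    by (auto simp: dist_real_def intro!: exI[of _ X])
qed

text \<open>
  Borel measures that are finite on compact sets; no regularity is needed for integrating
  functions in \<open>C\<^sub>c\<close>.
\<close>

locale locally_finite_borel_measure =
  fixes \<mu> :: "'a::t2_space measure"
  assumes sets_eq_borel [simp, measurable_cong]: "sets \<mu> = sets borel"
    and emeasure_compact: "compact K \<Longrightarrow> emeasure \<mu> K < \<infinity>"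
begin

lemma space_eq_UNIV [simp]: "space \<mu> = UNIV"
  using sets_eq_imp_space_eq[OF sets_eq_borel] by simp

lemma compact_in_sets [simp]: "compact K \<Longrightarrow> K \<in> sets borel" for K :: "'a set"
  by (simp add: borel_closed compact_imp_closed)

lemma integrable_indicator_compact: "compact K \<Longrightarrow> integrable \<mu> (indicator K :: 'a \<Rightarrow> real)"
  using emeasure_compact[of K] by (simp add: integrable_indicator_iff)

lemma integrable_Cc: 
  assumes "Cc f"
  shows "integrable \<mu> f"
proof -
  obtain K where K: "compact K" "\<And>x. x \<notin> K \<Longrightarrow> f x = 0"
    using assms by (auto simp: Cc_def)
  have "compact (f ` K)"
    using assms K(1) by (meson Cc_continuous compact_continuous_image continuous_on_subset subset_UNIV)
  then obtain B where B: "\<And>x. x \<in> K \<Longrightarrow> norm (f x) \<le> B"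
    using compact_imp_bounded[of "f ` K"] by (auto simp: bounded_iff)
  show ?thesis
  proof (rule Bochner_Integration.integrable_bound)
    show "integrable \<mu> (\<lambda>x. B * indicator K x)"
      using integrable_indicator_compact[OF K(1)] by simp
    show "f \<in> borel_measurable \<mu>"
      using Cc_measurable[OF assms] by simp
    show "AE x in \<mu>. norm (f x) \<le> norm (B * indicator K x)"
      using B K(2) by (intro AE_I2) (force simp: indicator_def abs_le_iff)
  qed
qed

lemma abs_integral_le_on_compact:
  fixes f :: "'a \<Rightarrow> real"
  assumes "compact K" "\<And>x. \<bar>f x\<bar> \<le> e * indicator K x"
  shows "\<bar>\<integral>x. f x \<partial>\<mu>\<bar> \<le> e * measure \<mu> K"
proof (cases "integrable \<mu> f")
  case True
  have "\<bar>\<integral>x. f x \<partial>\<mu>\<bar> \<le> (\<integral>x. \<bar>f x\<bar> \<partial>\<mu>)"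
    using integral_norm_bound[of \<mu> f] by simp
  also have "\<dots> \<le> (\<integral>x. e * indicator K x \<partial>\<mu>)"
    using True integrable_indicator_compact[OF assms(1)] assms(2) by (intro integral_mono) auto
  also have "\<dots> = e * measure \<mu> K"
    using assms(1) by simp
  finally show ?thesis .
next
  case False
  \<comment> \<open>The integral of a function that is not integrable is \<open>0\<close>, and \<open>e \<ge> 0\<close> unless \<open>K\<close> is empty.\<close>
  show ?thesis
  proof (cases "K = {}")
    case False
    then obtain x where "x \<in> K" by auto
    then have "0 \<le> e" using assms(2)[of x] by simp
    then show ?thesis
      using \<open>\<not> integrable \<mu> f\<close> by (simp add: not_integrable_integral_eq)
  qed (use \<open>\<not> integrable \<mu> f\<close> in \<open>simp add: not_integrable_integral_eq\<close>)
qed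

lemma continuous_on_parametric_integral:
  fixes h :: "'b::topological_space \<Rightarrow> 'a \<Rightarrow> real"
  assumes cont: "continuous_on UNIV (\<lambda>(x, y). h x y)"
    and L: "compact L" "\<And>x y. y \<notin> L \<Longrightarrow> h x y = 0"
  shows "continuous_on UNIV (\<lambda>x. \<integral>y. h x y \<partial>\<mu>)"
proof -
  have int: "integrable \<mu> (h x)" for x
    using continuous_slice(1)[OF cont] L by (intro integrable_Cc CcI[of _ L]) auto
  show ?thesis
    unfolding continuous_on_def
  proof (intro ballI tendstoI)
    fix x0 :: 'b and e :: real
    assume "0 < e"
    define m where "m = measure \<mu> L"
    have m: "0 \<le> m" by (simp add: m_def)
    have "0 < e / (m + 1)"
      using \<open>0 < e\<close> m by simp
    then obtain X where X: "x0 \<in> X" "open X" "\<forall>x\<in>X. \<forall>y\<in>L. \<bar>h x y - h x0 y\<bar> \<le> e / (m + 1)"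
      using uniformly_close_on_compact[OF cont L(1), of _ x0] by blast
    have "dist (\<integral>y. h x y \<partial>\<mu>) (\<integral>y. h x0 y \<partial>\<mu>) < e" if "x \<in> X" for x
    proof -
      have "\<bar>h x y - h x0 y\<bar> \<le> e / (m + 1) * indicator L y" for y
        using X(3) that L(2) by (auto simp: dist_real_def indicator_def)
      from abs_integral_le_on_compact[OF L(1) this]
      have "dist (\<integral>y. h x y \<partial>\<mu>) (\<integral>y. h x0 y \<partial>\<mu>) \<le> e / (m + 1) * m"
        using int by (simp add: dist_real_def m_def)
      also have "\<dots> < e"
        using \<open>0 < e\<close> m by (simp add: field_simps)
      finally show ?thesis .
    qed
    then show "\<forall>\<^sub>F x in at x0 within UNIV. dist (\<integral>y. h x y \<partial>\<mu>) (\<integral>y. h x0 y \<partial>\<mu>) < e"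
      using X(1,2) by (auto simp: eventually_at_topological)
  qed
qed

end

text \<open>
  Cover \<open>K\<close> by finitely many disjoint Borel pieces on each of which the slice \<open>h x\<close> is within
  \<open>e\<close> of a fixed slice \<open>h d\<close>. For the resulting step function in \<open>x\<close> both iterated integrals are
  the same finite sum, and replacing \<open>h\<close> by it costs at most \<open>e \<mu>(K) \<nu>(L)\<close> on each side.
\<close>

lemma Fubini_Cc:
  fixes h :: "'a::t2_space \<Rightarrow> 'b::t2_space \<Rightarrow> real"
  assumes M: "locally_finite_borel_measure \<mu>" and N: "locally_finite_borel_measure \<nu>"
    and cont: "continuous_on UNIV (\<lambda>(x, y). h x y)"
    and K: "compact K" "\<And>x y. x \<notin> K \<Longrightarrow> h x y = 0"
    and L: "compact L" "\<And>x y. y \<notin> L \<Longrightarrow> h x y = 0"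
  shows "(\<integral>x. (\<integral>y. h x y \<partial>\<nu>) \<partial>\<mu>) = (\<integral>y. (\<integral>x. h x y \<partial>\<mu>) \<partial>\<nu>)"
proof -
  interpret M: locally_finite_borel_measure \<mu> by fact
  interpret N: locally_finite_borel_measure \<nu> by fact
  define A where "A x = (\<integral>y. h x y \<partial>\<nu>)" for x
  define B where "B y = (\<integral>x. h x y \<partial>\<mu>)" for y
  define k l where "k = measure \<mu> K" and "l = measure \<nu> L"
  have cont': "continuous_on UNIV (\<lambda>(y, x). h x y)"
    using continuous_on_compose2[OF cont, of UNIV "\<lambda>(y, x). (x, y)"]
    by (simp add: case_prod_beta' continuous_intros)
  have "continuous_on UNIV A" "continuous_on UNIV B"
    unfolding A_def[abs_def] B_def[abs_def]
    by (rule N.continuous_on_parametric_integral[OF cont L] M.continuous_on_parametric_integral[OF cont' K]; assumption)+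
  then have int_AB: "integrable \<mu> A" "integrable \<nu> B"
    using K L by (auto intro!: M.integrable_Cc[OF CcI[of A K]] N.integrable_Cc[OF CcI[of B L]]
        simp: A_def B_def)
  have int_x: "integrable \<mu> (\<lambda>x. h x y)" for y
    using continuous_slice(2)[OF cont] K by (intro M.integrable_Cc CcI[of _ K]) auto
  have int_y: "integrable \<nu> (h x)" for x
    using continuous_slice(1)[OF cont] L by (intro N.integrable_Cc CcI[of _ L]) auto
  have approx: "\<bar>(\<integral>x. A x \<partial>\<mu>) - (\<integral>y. B y \<partial>\<nu>)\<bar> \<le> e * (2 * k * l)" if e: "0 < e" for e
  proof -
    obtain X where X: "\<And>x. x \<in> X x" "\<And>x. open (X x)"
      "\<And>x x' y. x' \<in> X x \<Longrightarrow> y \<in> L \<Longrightarrow> \<bar>h x' y - h x y\<bar> \<le> e"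
      using uniformly_close_on_compact[OF cont L(1) e] by metis
    obtain D where D: "D \<subseteq> K" "finite D" "K \<subseteq> (\<Union>d\<in>D. X d)"
      using compactE_image[OF K(1), of K X] X(1,2) by blast
    obtain P where P: "\<And>d. d \<in> D \<Longrightarrow> P d \<in> sets borel" "\<And>d. d \<in> D \<Longrightarrow> P d \<subseteq> X d"
      "disjoint_family_on P D" "(\<Union>d\<in>D. P d) = (\<Union>d\<in>D. X d)"
      using finite_borel_partition[OF D(2), of X borel] X(2) by auto
    \<comment> \<open>\<open>S\<close> is the common value of the iterated integrals of the step function \<open>h'\<close>.\<close>
    define S where "S = (\<Sum>d\<in>D. measure \<mu> (P d \<inter> K) * A d)"
    define h' where "h' x y = (\<Sum>d\<in>D. indicator (P d \<inter> K) x * h d y)" for x y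
    have PK: "integrable \<mu> (indicator (P d \<inter> K) :: _ \<Rightarrow> real)" if "d \<in> D" for d
    proof -
      have "emeasure \<mu> (P d \<inter> K) \<le> emeasure \<mu> K"
        using K(1) by (intro emeasure_mono) auto
      then have "emeasure \<mu> (P d \<inter> K) < \<infinity>"
        using M.emeasure_compact[OF K(1)] by (rule le_less_trans)
      then show ?thesis
        using P(1)[OF that] K(1) by (simp add: integrable_indicator_iff sets.Int)
    qed
    have close: "\<bar>h x y - h' x y\<bar> \<le> e * indicator K x * indicator L y" for x y
    proof (cases "x \<in> K \<and> y \<in> L")
      case True
      then obtain d where d: "d \<in> D" "x \<in> P d"
        using D(3) P(4) by blast
      have "h' x y = (\<Sum>d'\<in>{d}. indicator (P d' \<inter> K) x * h d' y)"
        unfolding h'_def using D(2) d P(3)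
        by (intro sum.mono_neutral_right) (auto simp: disjoint_family_on_def indicator_def)
      also have "\<dots> = h d y"
        using d True by simp
      finally show ?thesis
        using X(3)[of x d y] P(2)[OF d(1)] d(2) True by auto
    next
      case False
      then show ?thesis
        using K(2) L(2) by (auto simp: h'_def)
    qed
    have int_h'_y: "integrable \<nu> (h' x)" "(\<integral>y. h' x y \<partial>\<nu>) = (\<Sum>d\<in>D. indicator (P d \<inter> K) x * A d)" for x
      unfolding h'_def[abs_def] A_def using int_y by auto
    have int_h'_x: "integrable \<mu> (\<lambda>x. h' x y)" "(\<integral>x. h' x y \<partial>\<mu>) = (\<Sum>d\<in>D. measure \<mu> (P d \<inter> K) * h d y)" for y
      unfolding h'_def using PK by auto
    have "\<bar>A x - (\<integral>y. h' x y \<partial>\<nu>)\<bar> \<le> (e * l) * indicator K x" for x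
      using N.abs_integral_le_on_compact[OF L(1) close, of x] int_y int_h'_y(1)
      by (simp add: A_def l_def mult_ac)
    from M.abs_integral_le_on_compact[OF K(1) this]
    have 1: "\<bar>(\<integral>x. A x \<partial>\<mu>) - S\<bar> \<le> e * l * k"
      using int_AB(1) PK by (simp add: int_h'_y(2) S_def k_def)
    have "\<bar>B y - (\<integral>x. h' x y \<partial>\<mu>)\<bar> \<le> (e * k) * indicator L y" for y
    proof -
      have "\<bar>h x y - h' x y\<bar> \<le> (e * indicator L y) * indicator K x" for x
        using close[of x y] by (simp add: mult_ac)
      from M.abs_integral_le_on_compact[OF K(1) this] show ?thesis
        using int_x int_h'_x(1) by (simp add: B_def k_def mult_ac)
    qed
    from N.abs_integral_le_on_compact[OF L(1) this]
    have 2: "\<bar>(\<integral>y. B y \<partial>\<nu>) - S\<bar> \<le> e * k * l"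
      using int_AB(2) int_y by (simp add: int_h'_x(2) S_def l_def A_def)
    show ?thesis
      using 1 2 by (simp add: algebra_simps)
  qed
  have "((\<lambda>e. e * (2 * k * l)) \<longlongrightarrow> 0 * (2 * k * l)) (at_right 0)"
    by (intro tendsto_intros)
  then have "\<bar>(\<integral>x. A x \<partial>\<mu>) - (\<integral>y. B y \<partial>\<nu>)\<bar> \<le> 0 * (2 * k * l)"
    by (rule tendsto_lowerbound) (auto simp: eventually_at_right_less intro!: eventually_at_rightI[of 0 1] approx)
  then show ?thesis
    by (simp add: A_def B_def)
qed

section \<open>Haar measures and functions of compact support\<close>

lemma Cc_Urysohn:
  fixes K :: "'a::t2_space set"
  assumes lc: "locally_compact_space (euclidean :: 'a topology)"
    and "compact K" "open V" "K \<subseteq> V"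
  obtains f where "Cc f" "\<And>x. 0 \<le> f x" "\<And>x. f x \<le> 1" "\<And>x. x \<in> K \<Longrightarrow> f x = 1"
    "\<And>x. x \<notin> V \<Longrightarrow> f x = 0"
proof -
  have "Hausdorff_space (euclidean :: 'a topology)"
    using hausdorff by (fastforce simp: Hausdorff_space_def disjnt_def)
  note H = disjI1[OF this]
  obtain W L where W: "open W" "compact L" "K \<subseteq> W" "W \<subseteq> L"
    using lc assms(2) unfolding locally_compact_space_compact_closed_compact[OF H]
    by (auto simp: open_openin[symmetric])
  have "completely_regular_space (euclidean :: 'a topology)"
    by (rule locally_compact_regular_imp_completely_regular_space[OF lc H])
  then obtain f where f: "continuous_map euclidean (top_of_set {0..1::real}) f"
      "f ` (- (W \<inter> V)) \<subseteq> {0}" "f ` K \<subseteq> {1}"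
    using Urysohn_completely_regular_compact_closed[of 0 1 "euclidean :: 'a topology" K "- (W \<inter> V)"]
      assms W by (auto simp: disjnt_def closed_closedin[symmetric])
  show thesis
  proof
    have "f x = 0" if "x \<notin> L" for x
      using f(2) W(4) that by blast
    then show "Cc f"
      using f(1) W(2) by (intro CcI[of f L]) (auto simp: continuous_map_in_subtopology)
  qed (use f in \<open>auto simp: continuous_map_in_subtopology\<close>)
qed

lemma compact_plus_image:
  fixes K L :: "'a::topological_group_add set"
  assumes "compact K" "compact L"
  shows "compact ((\<lambda>(x, y). x + y) ` (K \<times> L))"
  by (intro compact_continuous_image compact_Times assms)
     (auto simp: case_prod_beta' intro!: continuous_intros)

lemma Cc_uminus:
  fixes f :: "'a::topological_group_add \<Rightarrow> real"
  assumes "Cc f"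
  shows "Cc (\<lambda>x. f (- x))"
proof -
  obtain K where K: "compact K" "\<And>x. x \<notin> K \<Longrightarrow> f x = 0"
    using assms by (auto simp: Cc_def)
  show ?thesis
  proof (rule CcI)
    show "continuous_on UNIV (\<lambda>x. f (- x))"
      by (rule continuous_on_compose2[OF Cc_continuous[OF assms]]) (auto intro!: continuous_intros)
    show "compact (uminus ` K)"
      by (intro compact_continuous_image K continuous_intros)
    show "f (- x) = 0" if "x \<notin> uminus ` K" for x
      using that K(2)[of "- x"] by (metis image_eqI minus_minus)
  qed
qed

lemma Cc_mult:
  assumes "Cc f" "continuous_on UNIV g"
  shows "Cc (\<lambda>x. f x * g x)"
  using assms by (auto simp: Cc_def intro!: continuous_intros)

text \<open>A locale that gives access to the defining properties of a fixed right Haar measure.\<close>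

locale right_haar =
  fixes \<mu> :: "'a::{topological_group_add,t2_space} measure"
  assumes haar: "right_haar_measure \<mu>"

sublocale right_haar \<subseteq> locally_finite_borel_measure \<mu>
  using haar by unfold_locales (auto simp: right_haar_measure_def)

context right_haar
begin

lemma measurable_right_translate [measurable]: "(\<lambda>y. y + x) \<in> measurable borel borel" for x :: 'a
  by (intro borel_measurable_continuous_onI continuous_intros)

lemma distr_right_translate: "distr \<mu> borel (\<lambda>y. y + x) = \<mu>"
  using haar by (simp add: right_haar_measure_def)

lemma integral_right_translate:
  fixes f :: "'a \<Rightarrow> real"
  assumes "f \<in> borel_measurable borel"
  shows "(\<integral>y. f (y + x) \<partial>\<mu>) = (\<integral>y. f y \<partial>\<mu>)"
  using integral_distr[of "\<lambda>y. y + x" \<mu> borel f] assms by (simp add: distr_right_translate)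

lemma emeasure_open_inner: "open V \<Longrightarrow> emeasure \<mu> V = (SUP K\<in>{K. compact K \<and> K \<subseteq> V}. emeasure \<mu> K)"
  using haar unfolding right_haar_measure_def by blast

lemma emeasure_borel_outer: "A \<in> sets borel \<Longrightarrow> emeasure \<mu> A = (INF V\<in>{V. open V \<and> A \<subseteq> V}. emeasure \<mu> V)"
  using haar unfolding right_haar_measure_def by blast

lemma emeasure_UNIV_nonzero: "emeasure \<mu> UNIV \<noteq> 0"
  using haar unfolding right_haar_measure_def by blast

text \<open>
  Every compact set is covered by finitely many right translates of \<open>V\<close>, so if \<open>V\<close> were null, then
  inner regularity would make the whole group null.
\<close>

lemma emeasure_open_nonzero:
  assumes "open V" "V \<noteq> {}"
  shows "emeasure \<mu> V \<noteq> 0"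
proof
  assume V0: "emeasure \<mu> V = 0"
  obtain v where v: "v \<in> V" using assms by auto
  define W where "W k = (\<lambda>x. x + (- k + v)) -` V" for k
  have openW: "open (W k)" for k
    unfolding W_def by (intro open_vimage assms continuous_intros)
  have null: "W k \<in> null_sets \<mu>" for k
    using emeasure_distr[of "\<lambda>y. y + (- k + v)" \<mu> borel V] V0 openW assms
    by (intro null_setsI) (auto simp: distr_right_translate W_def)
  have "emeasure \<mu> K = 0" if K: "compact K" for K
  proof -
    have "k \<in> W k" for k
      using v by (simp add: W_def flip: add.assoc)
    then have "K \<subseteq> (\<Union>k\<in>K. W k)"
      by auto
    then obtain D where D: "finite D" "K \<subseteq> (\<Union>k\<in>D. W k)"
      by (rule compactE_image[OF K openW])
    have "(\<Union>k\<in>D. W k) \<in> null_sets \<mu>"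
      using D(1) null by auto
    then have "K \<in> null_sets \<mu>"
      by (rule null_sets_subset) (use D K in auto)
    then show ?thesis by auto
  qed
  then have "emeasure \<mu> UNIV \<le> 0"
    unfolding emeasure_open_inner[OF open_UNIV] by (intro SUP_least) auto
  then show False
    using emeasure_UNIV_nonzero by simp
qed

lemma integral_Cc_pos:
  assumes "Cc f" "\<And>x. 0 \<le> f x" "f a \<noteq> 0"
  shows "0 < (\<integral>x. f x \<partial>\<mu>)"
proof -
  have "open {x. f x \<noteq> 0}"
    using Cc_continuous[OF assms(1)] by (intro open_Collect_neq) auto
  then have "emeasure \<mu> {x. f x \<noteq> 0} \<noteq> 0"
    using assms(3) by (intro emeasure_open_nonzero) auto
  then have "\<not> (AE x in \<mu>. f x = 0)"
    using \<open>open {x. f x \<noteq> 0}\<close> by (subst AE_iff_measurable[of "{x. f x \<noteq> 0}"]) auto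
  then have "(\<integral>x. f x \<partial>\<mu>) \<noteq> 0"
    using integral_nonneg_eq_0_iff_AE[OF integrable_Cc[OF assms(1)]] assms(2) by simp
  moreover have "0 \<le> (\<integral>x. f x \<partial>\<mu>)"
    using assms(2) by simp
  ultimately show ?thesis
    by simp
qed

end

lemma continuous_on_comp_UNIV:
  assumes "continuous_on UNIV f" "continuous_on S g"
  shows "continuous_on S (\<lambda>x. f (g x))"
  using continuous_on_compose2[OF assms] by simp

section \<open>Uniqueness of Haar measure\<close>

text \<open>
  The factor \<open>g s\<close> confines the inner integration to one compact set for all \<open>s\<close>, which
  yields the continuity in \<open>s\<close>.
\<close>

lemma Cc_left_translate_integral:
  fixes \<nu> :: "'a::{topological_group_add,t2_space} measure"
  assumes N: "locally_finite_borel_measure \<nu>" and f: "Cc f" and g: "Cc g"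
  shows "Cc (\<lambda>s. g s * (\<integral>t. f (s + t) \<partial>\<nu>))"
proof -
  interpret N: locally_finite_borel_measure \<nu> by fact
  obtain Kf where Kf: "compact Kf" "\<And>x. x \<notin> Kf \<Longrightarrow> f x = 0"
    using f by (auto simp: Cc_def)
  obtain Kg where Kg: "compact Kg" "\<And>x. x \<notin> Kg \<Longrightarrow> g x = 0"
    using g by (auto simp: Cc_def)
  note cont = continuous_on_comp_UNIV[OF Cc_continuous[OF f]] continuous_on_comp_UNIV[OF Cc_continuous[OF g]]
  have "continuous_on UNIV (\<lambda>s. \<integral>t. g s * f (s + t) \<partial>\<nu>)"
  proof (rule N.continuous_on_parametric_integral)
    show "continuous_on UNIV (\<lambda>(s, t). g s * f (s + t))"
      unfolding case_prod_beta' by (intro continuous_intros cont)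
    show "compact ((\<lambda>(x, y). x + y) ` (uminus ` Kg \<times> Kf))"
      by (intro compact_plus_image compact_continuous_image Kg Kf continuous_intros)
    show "g s * f (s + t) = 0" if "t \<notin> (\<lambda>(x, y). x + y) ` (uminus ` Kg \<times> Kf)" for s t
    proof (rule ccontr)
      assume "g s * f (s + t) \<noteq> 0"
      then have "(- s, s + t) \<in> uminus ` Kg \<times> Kf"
        using Kf Kg by auto
      from imageI[OF this, of "\<lambda>(x, y). x + y"] that show False
        by (simp add: add.assoc[symmetric])
    qed
  qed
  then show ?thesis
    using Kg by (intro CcI[of _ Kg]) auto
qed

text \<open>
  Starting from the product of the integrals, the substitutions are \<open>t \<mapsto> t - s\<close> in the integral
  over \<open>\<nu>\<close> and, after exchanging the integrals, \<open>s \<mapsto> s + t\<close> in the integral over \<open>\<mu>\<close>. Both are right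
  translations, and \<open>t - (s + t) = - s\<close>.
\<close>

lemma Haar_Fubini_identity:
  fixes \<mu> \<nu> :: "'a::{topological_group_add,t2_space} measure"
  assumes M: "right_haar_measure \<mu>" and N: "right_haar_measure \<nu>" and f: "Cc f" and g: "Cc g"
  shows "(\<integral>s. g (- s) * (\<integral>t. f (s + t) \<partial>\<nu>) \<partial>\<mu>) = (\<integral>s. f s \<partial>\<mu>) * (\<integral>t. g t \<partial>\<nu>)"
proof -
  interpret M: right_haar \<mu> by unfold_locales fact
  interpret N: right_haar \<nu> by unfold_locales fact
  obtain Kf where Kf: "compact Kf" "\<And>x. x \<notin> Kf \<Longrightarrow> f x = 0"
    using f by (auto simp: Cc_def)
  obtain Kg where Kg: "compact Kg" "\<And>x. x \<notin> Kg \<Longrightarrow> g x = 0"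
    using g by (auto simp: Cc_def)
  define S where "S = (\<lambda>(x, y). x + y) ` (Kg \<times> Kf)"
  have S: "compact S"
    unfolding S_def by (intro compact_plus_image Kg Kf)
  have SI: "x + y \<in> S" if "x \<in> Kg" "y \<in> Kf" for x y
    using that by (force simp: S_def)
  note cont = continuous_on_comp_UNIV[OF Cc_continuous[OF f]] continuous_on_comp_UNIV[OF Cc_continuous[OF g]]
  have "(\<integral>s. f s \<partial>\<mu>) * (\<integral>t. g t \<partial>\<nu>) = (\<integral>s. f s * (\<integral>t. g t \<partial>\<nu>) \<partial>\<mu>)"
    by simp
  also have "\<dots> = (\<integral>s. (\<integral>t. f s * g (t - s) \<partial>\<nu>) \<partial>\<mu>)"
    using N.integral_right_translate[OF Cc_measurable[OF g], of "- _"] by simp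
  also have "\<dots> = (\<integral>t. (\<integral>s. f s * g (t - s) \<partial>\<mu>) \<partial>\<nu>)"
  proof (rule Fubini_Cc[OF M.locally_finite_borel_measure_axioms N.locally_finite_borel_measure_axioms _ Kf(1) _ S])
    show "continuous_on UNIV (\<lambda>(s, t). f s * g (t - s))"
      unfolding case_prod_beta' by (intro continuous_intros cont)
    show "f s * g (t - s) = 0" if "t \<notin> S" for s t
      using that Kf(2)[of s] Kg(2)[of "t - s"] SI[of "t - s" s] by auto
  qed (use Kf in auto)
  also have "\<dots> = (\<integral>t. (\<integral>s. g (- s) * f (s + t) \<partial>\<mu>) \<partial>\<nu>)"
  proof (rule Bochner_Integration.integral_cong[OF refl])
    fix t
    have "continuous_on UNIV (\<lambda>s. f s * g (t - s))"
      by (intro continuous_intros cont)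
    from M.integral_right_translate[OF borel_measurable_continuous_onI[OF this], of t]
    show "(\<integral>s. f s * g (t - s) \<partial>\<mu>) = (\<integral>s. g (- s) * f (s + t) \<partial>\<mu>)"
      by (simp add: diff_conv_add_uminus minus_add mult.commute add.assoc[symmetric] del: add_uminus_conv_diff)
  qed
  also have "\<dots> = (\<integral>s. (\<integral>t. g (- s) * f (s + t) \<partial>\<nu>) \<partial>\<mu>)"
  proof (rule Fubini_Cc[symmetric, OF M.locally_finite_borel_measure_axioms N.locally_finite_borel_measure_axioms _ _ _ S])
    show "continuous_on UNIV (\<lambda>(s, t). g (- s) * f (s + t))"
      unfolding case_prod_beta' by (intro continuous_intros cont)
    show "compact (uminus ` Kg)"
      by (intro compact_continuous_image Kg continuous_intros)
    show "g (- s) * f (s + t) = 0" if "s \<notin> uminus ` Kg" for s t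
      using that Kg(2)[of "- s"] by (metis image_eqI minus_minus mult_zero_left)
    show "g (- s) * f (s + t) = 0" if "t \<notin> S" for s t
      using that Kg(2)[of "- s"] Kf(2)[of "s + t"] SI[of "- s" "s + t"] by (auto simp: add.assoc[symmetric])
  qed
  finally show ?thesis
    by simp
qed

text \<open>
  With \<open>E\<^sub>i(s) = \<integral> f\<^sub>i(s + t) d\<nu>(t)\<close>, the function
  \<open>F(s) = (\<integral> f\<^sub>2 d\<mu>) E\<^sub>1(s) - (\<integral> f\<^sub>1 d\<mu>) E\<^sub>2(s)\<close> is orthogonal to
  \<open>C\<^sub>c\<close> by the previous identity, and the claim is \<open>F(0) = 0\<close>. For a cut-off function \<open>\<psi>\<close> with
  \<open>\<psi>(0) = 1\<close>, testing against \<open>\<psi>\<^sup>2 F\<close> gives \<open>\<integral> (\<psi> F)\<^sup>2 d\<mu> = 0\<close>. Below, \<open>G\<close> is \<open>\<psi> F\<close>.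
\<close>

lemma Haar_integrals_cross_multiply:
  fixes \<mu> \<nu> :: "'a::{topological_group_add,t2_space} measure"
  assumes lc: "locally_compact_space (euclidean :: 'a topology)"
    and M: "right_haar_measure \<mu>" and N: "right_haar_measure \<nu>" and f1: "Cc f1" and f2: "Cc f2"
  shows "(\<integral>x. f2 x \<partial>\<mu>) * (\<integral>x. f1 x \<partial>\<nu>) = (\<integral>x. f1 x \<partial>\<mu>) * (\<integral>x. f2 x \<partial>\<nu>)"
proof -
  interpret M: right_haar \<mu> by unfold_locales fact
  interpret N: right_haar \<nu> by unfold_locales fact
  obtain \<psi> :: "'a \<Rightarrow> real" where \<psi>: "Cc \<psi>" "\<psi> 0 = 1"
    by (rule Cc_Urysohn[OF lc, of "{0}" UNIV]) auto
  define I1 I2 where "I1 = (\<integral>x. f1 x \<partial>\<mu>)" and "I2 = (\<integral>x. f2 x \<partial>\<mu>)"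
  define E1 E2 where "E1 s = (\<integral>t. f1 (s + t) \<partial>\<nu>)" and "E2 s = (\<integral>t. f2 (s + t) \<partial>\<nu>)" for s
  have C: "Cc (\<lambda>s. \<psi> s * E1 s)" "Cc (\<lambda>s. \<psi> s * E2 s)"
    unfolding E1_def E2_def
    by (rule Cc_left_translate_integral[OF N.locally_finite_borel_measure_axioms _ \<psi>(1)]; fact)+
  define G where "G s = I2 * (\<psi> s * E1 s) - I1 * (\<psi> s * E2 s)" for s
  have contG: "continuous_on UNIV G"
    unfolding G_def by (intro continuous_intros C[THEN Cc_continuous])
  \<comment> \<open>The identity evaluates the test function at \<open>- s\<close>, whence the reflection.\<close>
  define g where "g x = \<psi> (- x) * G (- x)" for x
  have "Cc g"
    unfolding g_def by (rule Cc_uminus[OF Cc_mult[OF \<psi>(1) contG]])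
  have 1: "(\<integral>s. \<psi> s * E1 s * G s \<partial>\<mu>) = I1 * (\<integral>t. g t \<partial>\<nu>)"
    using Haar_Fubini_identity[OF M N f1 \<open>Cc g\<close>] by (simp add: g_def E1_def I1_def mult_ac)
  have 2: "(\<integral>s. \<psi> s * E2 s * G s \<partial>\<mu>) = I2 * (\<integral>t. g t \<partial>\<nu>)"
    using Haar_Fubini_identity[OF M N f2 \<open>Cc g\<close>] by (simp add: g_def E2_def I2_def mult_ac)
  have int: "integrable \<mu> (\<lambda>s. \<psi> s * E1 s * G s)" "integrable \<mu> (\<lambda>s. \<psi> s * E2 s * G s)"
    by (intro M.integrable_Cc Cc_mult C contG)+
  have "(\<integral>s. G s * G s \<partial>\<mu>) = (\<integral>s. I2 * (\<psi> s * E1 s * G s) - I1 * (\<psi> s * E2 s * G s) \<partial>\<mu>)"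
    by (intro Bochner_Integration.integral_cong refl) (simp add: G_def algebra_simps)
  also have "\<dots> = 0"
    using int by (simp add: 1 2)
  finally have "(\<integral>s. G s * G s \<partial>\<mu>) = 0" .
  moreover have "Cc (\<lambda>s. G s * G s)"
  proof -
    obtain K where "compact K" "\<And>x. x \<notin> K \<Longrightarrow> \<psi> x = 0"
      using \<psi> by (auto simp: Cc_def)
    then show ?thesis
      by (intro CcI[of _ K] continuous_intros contG) (auto simp: G_def)
  qed
  ultimately have "G 0 = 0"
    using M.integral_Cc_pos[of "\<lambda>s. G s * G s" 0] by auto
  then show ?thesis
    by (simp add: G_def \<psi>(2) E1_def E2_def I1_def I2_def)
qed

text \<open>Open sets are compared through Urysohn functions; outer regularity extends this to Borel sets.\<close>

lemma Haar_emeasure_le: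
  fixes \<mu> \<nu> :: "'a::{topological_group_add,t2_space} measure"
  assumes lc: "locally_compact_space (euclidean :: 'a topology)"
    and M: "right_haar_measure \<mu>" and N: "right_haar_measure \<nu>" and "0 < c"
    and eq: "\<And>f. Cc f \<Longrightarrow> (\<integral>x. f x \<partial>\<nu>) = c * (\<integral>x. f x \<partial>\<mu>)"
    and A: "A \<in> sets borel"
  shows "emeasure \<nu> A \<le> ennreal c * emeasure \<mu> A"
proof -
  interpret M: right_haar \<mu> by unfold_locales fact
  interpret N: right_haar \<nu> by unfold_locales fact
  have opn: "emeasure \<nu> V \<le> ennreal c * emeasure \<mu> V" if V: "open V" for V
    unfolding N.emeasure_open_inner[OF V]
  proof (rule SUP_least, safe)
    fix K assume K: "compact K" "K \<subseteq> V"
    obtain f where f: "Cc f" "\<And>x. 0 \<le> f x" "\<And>x. f x \<le> 1" "\<And>x. x \<in> K \<Longrightarrow> f x = 1"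
      "\<And>x. x \<notin> V \<Longrightarrow> f x = 0"
      by (rule Cc_Urysohn[OF lc K(1) V K(2)]) blast
    have "emeasure \<nu> K = (\<integral>\<^sup>+x. indicator K x \<partial>\<nu>)"
      using K(1) by simp
    also have "\<dots> \<le> (\<integral>\<^sup>+x. ennreal (f x) \<partial>\<nu>)"
      using f(4) by (intro nn_integral_mono) (auto simp: indicator_def)
    also have "\<dots> = ennreal (\<integral>x. f x \<partial>\<nu>)"
      using N.integrable_Cc[OF f(1)] f(2) by (intro nn_integral_eq_integral) auto
    also have "\<dots> = ennreal c * ennreal (\<integral>x. f x \<partial>\<mu>)"
      using eq[OF f(1)] \<open>0 < c\<close> f(2) by (simp add: ennreal_mult)
    also have "ennreal (\<integral>x. f x \<partial>\<mu>) = (\<integral>\<^sup>+x. ennreal (f x) \<partial>\<mu>)"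
      using M.integrable_Cc[OF f(1)] f(2) by (intro nn_integral_eq_integral[symmetric]) auto
    also have "\<dots> \<le> (\<integral>\<^sup>+x. indicator V x \<partial>\<mu>)"
      using f(3,5) by (intro nn_integral_mono) (auto simp: indicator_def)
    also have "\<dots> = emeasure \<mu> V"
      using V by simp
    finally show "emeasure \<nu> K \<le> ennreal c * emeasure \<mu> V"
      by (simp add: mult_left_mono)
  qed
  have cc: "ennreal c * ennreal (1 / c) = 1"
    using \<open>0 < c\<close> by (simp flip: ennreal_mult)
  have "ennreal (1 / c) * emeasure \<nu> A \<le> emeasure \<mu> A"
    unfolding M.emeasure_borel_outer[OF A]
  proof (rule INF_greatest, safe)
    fix V assume V: "open V" "A \<subseteq> V"
    have "emeasure \<nu> A \<le> emeasure \<nu> V"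
      using V by (intro emeasure_mono) auto
    also have "\<dots> \<le> ennreal c * emeasure \<mu> V"
      by (rule opn) fact
    finally have "ennreal (1 / c) * emeasure \<nu> A \<le> ennreal (1 / c) * (ennreal c * emeasure \<mu> V)"
      by (rule mult_left_mono) simp
    also have "\<dots> = emeasure \<mu> V"
      using cc by (simp add: mult.commute flip: mult.assoc)
    finally show "ennreal (1 / c) * emeasure \<nu> A \<le> emeasure \<mu> V" .
  qed
  then have "ennreal c * (ennreal (1 / c) * emeasure \<nu> A) \<le> ennreal c * emeasure \<mu> A"
    by (rule mult_left_mono) simp
  then show ?thesis
    by (simp add: cc flip: mult.assoc)
qed

theorem Haar_measure_unique:
  fixes \<mu> \<nu> :: "'a::{topological_group_add,t2_space} measure"
  assumes lc: "locally_compact_space (euclidean :: 'a topology)"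
    and M: "right_haar_measure \<mu>" and N: "right_haar_measure \<nu>"
  shows "\<exists>c>0. \<nu> = scale_measure (ennreal c) \<mu>"
proof -
  interpret M: right_haar \<mu> by unfold_locales fact
  interpret N: right_haar \<nu> by unfold_locales fact
  obtain \<phi> :: "'a \<Rightarrow> real" where \<phi>: "Cc \<phi>" "\<And>x. 0 \<le> \<phi> x" "\<phi> 0 = 1"
    by (rule Cc_Urysohn[OF lc, of "{0}" UNIV]) auto
  have pos: "0 < (\<integral>x. \<phi> x \<partial>\<mu>)" "0 < (\<integral>x. \<phi> x \<partial>\<nu>)"
    using M.integral_Cc_pos[of \<phi> 0] N.integral_Cc_pos[of \<phi> 0] \<phi> by auto
  define c where "c = (\<integral>x. \<phi> x \<partial>\<nu>) / (\<integral>x. \<phi> x \<partial>\<mu>)"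
  have c: "0 < c" "0 < 1 / c"
    using pos by (auto simp: c_def)
  have eq: "(\<integral>x. f x \<partial>\<nu>) = c * (\<integral>x. f x \<partial>\<mu>)" "(\<integral>x. f x \<partial>\<mu>) = 1 / c * (\<integral>x. f x \<partial>\<nu>)"
    if "Cc f" for f
    using Haar_integrals_cross_multiply[OF lc M N that \<phi>(1)] pos by (simp_all add: c_def field_simps)
  have "\<nu> = scale_measure (ennreal c) \<mu>"
  proof (rule measure_eqI)
    fix A assume "A \<in> sets \<nu>"
    then have A: "A \<in> sets borel" by simp
    have "emeasure \<nu> A \<le> ennreal c * emeasure \<mu> A"
      by (rule Haar_emeasure_le[OF lc M N c(1) eq(1) A])
    moreover have "ennreal c * emeasure \<mu> A \<le> ennreal c * (ennreal (1 / c) * emeasure \<nu> A)"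
      by (rule mult_left_mono[OF Haar_emeasure_le[OF lc N M c(2) eq(2) A]]) auto
    moreover have "ennreal c * (ennreal (1 / c) * emeasure \<nu> A) = emeasure \<nu> A"
      using c by (simp add: flip: mult.assoc ennreal_mult)
    ultimately show "emeasure \<nu> A = emeasure (scale_measure (ennreal c) \<mu>) A"
      by auto
  qed simp
  with c(1) show ?thesis by blast
qed

section \<open>Automorphisms and the modular constant\<close>

lemma top_automorphismD:
  assumes "top_automorphism \<alpha>"
  shows "continuous_on UNIV \<alpha>" "continuous_on UNIV (inv \<alpha>)" "bij \<alpha>"
    "\<And>x y. \<alpha> (x + y) = \<alpha> x + \<alpha> y"
proof -
  have hom: "homeomorphic_map euclidean euclidean \<alpha>" and add: "\<And>x y. \<alpha> (x + y) = \<alpha> x + \<alpha> y"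
    using assms by (auto simp: top_automorphism_def)
  obtain \<beta> where \<beta>: "homeomorphic_maps euclidean euclidean \<alpha> \<beta>"
    using hom homeomorphic_map_maps by blast
  then have inv: "\<And>x. \<beta> (\<alpha> x) = x" "\<And>x. \<alpha> (\<beta> x) = x"
    by (auto simp: homeomorphic_maps_def)
  then have "inv \<alpha> = \<beta>"
    by (intro inv_equality) auto
  moreover have "bij \<alpha>"
    using inv by (intro o_bij[of \<beta>]) (auto simp: fun_eq_iff)
  ultimately show "continuous_on UNIV \<alpha>" "continuous_on UNIV (inv \<alpha>)" "bij \<alpha>"
    "\<And>x y. \<alpha> (x + y) = \<alpha> x + \<alpha> y"
    using \<beta> add by (auto simp: homeomorphic_maps_def)
qed

lemma top_automorphismI:
  assumes "continuous_on UNIV \<alpha>" "continuous_on UNIV (inv \<alpha>)" "bij \<alpha>"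
    "\<And>x y. \<alpha> (x + y) = \<alpha> x + \<alpha> y"
  shows "top_automorphism \<alpha>"
proof -
  have "homeomorphic_maps euclidean euclidean \<alpha> (inv \<alpha>)"
    using assms by (auto simp: homeomorphic_maps_def bij_is_inj bij_is_surj surj_f_inv_f)
  then have "homeomorphic_map euclidean euclidean \<alpha>"
    unfolding homeomorphic_map_maps by blast
  then show ?thesis
    using assms(4) by (simp add: top_automorphism_def)
qed

lemma top_automorphism_uminus:
  assumes "top_automorphism \<alpha>"
  shows "\<alpha> (- x) = - \<alpha> x"
proof -
  have add: "\<And>x y. \<alpha> (x + y) = \<alpha> x + \<alpha> y"
    using assms by (rule top_automorphismD)
  have "\<alpha> 0 = 0"
    using add[of 0 0] add_left_cancel[of "\<alpha> 0" "\<alpha> 0" 0] by simp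
  then show ?thesis
    using add[of "- x" x] by (simp add: eq_neg_iff_add_eq_0)
qed

lemma top_automorphism_comp:
  assumes "top_automorphism \<alpha>" "top_automorphism \<beta>"
  shows "top_automorphism (\<alpha> \<circ> \<beta>)"
  using assms by (auto simp: top_automorphism_def intro: homeomorphic_map_compose)

lemma top_automorphism_inv:
  assumes "top_automorphism \<alpha>"
  shows "top_automorphism (inv \<alpha>)"
proof -
  note \<alpha> = top_automorphismD[OF assms]
  have "inv \<alpha> (x + y) = inv \<alpha> x + inv \<alpha> y" for x y
    using \<alpha>(3,4) by (metis bij_inv_eq_iff)
  then show ?thesis
    using \<alpha> by (intro top_automorphismI) (auto simp: bij_imp_bij_inv inv_inv_eq)
qed

text \<open>
  Reindexes the families in the definitions of outer and inner regularity along a bijection that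
  preserves a class \<open>P\<close> of sets, such as the open or the compact ones.
\<close>

lemma bij_vimage_reindex:
  assumes "bij \<alpha>" "\<And>V. P (\<alpha> -` V) \<longleftrightarrow> P V"
  shows "{V. P V \<and> \<alpha> -` A \<subseteq> V} = (\<lambda>V. \<alpha> -` V) ` {V. P V \<and> A \<subseteq> V}"
    and "{V. P V \<and> V \<subseteq> \<alpha> -` A} = (\<lambda>V. \<alpha> -` V) ` {V. P V \<and> V \<subseteq> A}"
proof -
  have V: "V = \<alpha> -` (\<alpha> ` V)" for V
    using assms(1) by (simp add: bij_is_inj inj_vimage_image_eq)
  have sub: "\<alpha> -` V \<subseteq> \<alpha> -` W \<longleftrightarrow> V \<subseteq> W" for V W
    using assms(1) by (metis bij_is_surj surj_image_vimage_eq image_mono vimage_mono)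
  show "{V. P V \<and> \<alpha> -` A \<subseteq> V} = (\<lambda>V. \<alpha> -` V) ` {V. P V \<and> A \<subseteq> V}"
  proof safe
    fix V assume "P V" "\<alpha> -` A \<subseteq> V"
    then show "V \<in> (\<lambda>V. \<alpha> -` V) ` {V. P V \<and> A \<subseteq> V}"
      using V[of V] assms(2)[of "\<alpha> ` V"] sub[of A "\<alpha> ` V"] by (intro image_eqI[of _ _ "\<alpha> ` V"]) auto
  qed (use assms(2) in auto)
  show "{V. P V \<and> V \<subseteq> \<alpha> -` A} = (\<lambda>V. \<alpha> -` V) ` {V. P V \<and> V \<subseteq> A}"
  proof safe
    fix V assume "P V" "V \<subseteq> \<alpha> -` A"
    then show "V \<in> (\<lambda>V. \<alpha> -` V) ` {V. P V \<and> V \<subseteq> A}"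
      using V[of V] assms(2)[of "\<alpha> ` V"] sub[of "\<alpha> ` V" A] by (intro image_eqI[of _ _ "\<alpha> ` V"]) auto
  qed (use assms(2) in auto)
qed

lemma right_haar_measure_distr_automorphism:
  fixes \<rho> :: "'a::{topological_group_add,t2_space} measure"
  assumes R: "right_haar_measure \<rho>" and \<alpha>: "top_automorphism \<alpha>"
  shows "right_haar_measure (distr \<rho> borel \<alpha>)"
proof -
  note a = top_automorphismD[OF \<alpha>]
  interpret R: right_haar \<rho> by unfold_locales fact
  have [measurable]: "\<alpha> \<in> borel_measurable borel"
    using a(1) by (rule borel_measurable_continuous_onI)
  have vim: "\<alpha> -` V = inv \<alpha> ` V" for V
    using a(3) by (rule bij_vimage_eq_inv_image)
  have em: "emeasure (distr \<rho> borel \<alpha>) A = emeasure \<rho> (\<alpha> -` A)" if "A \<in> sets borel" for A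
    using that by (subst emeasure_distr) auto
  have opn: "open (\<alpha> -` V) \<longleftrightarrow> open V" for V
  proof
    assume "open (\<alpha> -` V)"
    then have "open (inv \<alpha> -` (\<alpha> -` V))"
      using a(2) by (rule open_vimage)
    moreover have "inv \<alpha> -` (\<alpha> -` V) = V"
      using a(3) by (auto simp: bij_is_surj surj_f_inv_f)
    ultimately show "open V" by simp
  next
    assume "open V"
    then show "open (\<alpha> -` V)"
      using a(1) by (rule open_vimage)
  qed
  have cpt: "compact (\<alpha> -` V) \<longleftrightarrow> compact V" for V
  proof
    assume "compact (\<alpha> -` V)"
    then have "compact (\<alpha> ` (\<alpha> -` V))"
      by (rule compact_continuous_image[OF continuous_on_subset[OF a(1)], rotated]) auto
    then show "compact V"
      using a(3) by (simp add: bij_is_surj surj_image_vimage_eq)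
  next
    assume "compact V"
    then show "compact (\<alpha> -` V)"
      unfolding vim by (rule compact_continuous_image[OF continuous_on_subset[OF a(2)], rotated]) auto
  qed
  show ?thesis
    unfolding right_haar_measure_def
  proof (intro conjI allI impI ballI)
    show "emeasure (distr \<rho> borel \<alpha>) K < \<infinity>" if "compact K" for K
      using R.emeasure_compact[of "\<alpha> -` K"] cpt[of K] that by (simp add: em)
    show "emeasure (distr \<rho> borel \<alpha>) A = (INF V\<in>{V. open V \<and> A \<subseteq> V}. emeasure (distr \<rho> borel \<alpha>) V)"
      if A: "A \<in> sets borel" for A
    proof -
      have "\<alpha> -` A \<in> sets borel"
        using measurable_sets[of \<alpha> borel borel A] A by simp
      then have "emeasure (distr \<rho> borel \<alpha>) A = (INF V\<in>{V. open V \<and> \<alpha> -` A \<subseteq> V}. emeasure \<rho> V)"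
        using A by (simp add: em R.emeasure_borel_outer)
      also have "\<dots> = (INF V\<in>{V. open V \<and> A \<subseteq> V}. emeasure \<rho> (\<alpha> -` V))"
        unfolding bij_vimage_reindex(1)[OF a(3), where P="open", OF opn] by (simp add: image_image)
      finally show ?thesis
        by (simp add: em cong: INF_cong_simp)
    qed
    show "emeasure (distr \<rho> borel \<alpha>) V = (SUP K\<in>{K. compact K \<and> K \<subseteq> V}. emeasure (distr \<rho> borel \<alpha>) K)"
      if V: "open V" for V
    proof -
      have "emeasure (distr \<rho> borel \<alpha>) V = (SUP K\<in>{K. compact K \<and> K \<subseteq> \<alpha> -` V}. emeasure \<rho> K)"
        using V opn[of V] by (simp add: em R.emeasure_open_inner)
      also have "\<dots> = (SUP K\<in>{K. compact K \<and> K \<subseteq> V}. emeasure \<rho> (\<alpha> -` K))"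
        unfolding bij_vimage_reindex(2)[OF a(3), where P=compact, OF cpt] by (simp add: image_image)
      finally show ?thesis
        by (simp add: em cong: SUP_cong_simp)
    qed
    show "emeasure (distr \<rho> borel \<alpha>) UNIV \<noteq> 0"
      using R.emeasure_UNIV_nonzero by (simp add: em)
    show "distr (distr \<rho> borel \<alpha>) borel (\<lambda>y. y + x) = distr \<rho> borel \<alpha>" for x
    proof -
      have "(\<lambda>y. y + x) \<circ> \<alpha> = \<alpha> \<circ> (\<lambda>y. y + inv \<alpha> x)"
        using a(3,4) by (auto simp: bij_is_surj surj_f_inv_f)
      then have "distr (distr \<rho> borel \<alpha>) borel (\<lambda>y. y + x) = distr (distr \<rho> borel (\<lambda>y. y + inv \<alpha> x)) borel \<alpha>"
        by (simp add: distr_distr)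
      then show ?thesis
        by (simp add: R.distr_right_translate)
    qed
  qed simp
qed

text \<open>
  The topological automorphism \<open>\<alpha>\<close> multiplies \<open>\<rho>\<close> by the constant \<open>c > 0\<close>, in the sense
  \<open>\<alpha>\<^sub>*\<rho> = c \<rho>\<close>. Under composition of automorphisms the constants multiply.
\<close>

definition scales_measure ::
    "'a::{topological_group_add,t2_space} measure \<Rightarrow> ('a \<Rightarrow> 'a) \<Rightarrow> real \<Rightarrow> bool" where
  "scales_measure \<rho> \<alpha> c \<longleftrightarrow>
     top_automorphism \<alpha> \<and> 0 < c \<and> distr \<rho> borel \<alpha> = scale_measure (ennreal c) \<rho>"

lemma scales_measureD:
  assumes "scales_measure \<rho> \<alpha> c"
  shows "top_automorphism \<alpha>" "0 < c" "distr \<rho> borel \<alpha> = scale_measure (ennreal c) \<rho>"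
    "\<alpha> \<in> borel_measurable borel"
  using assms by (auto simp: scales_measure_def intro: borel_measurable_continuous_onI top_automorphismD(1))

lemma scales_measure_modular_hom:
  fixes \<rho> :: "'a::{topological_group_add,t2_space} measure"
  assumes lc: "locally_compact_space (euclidean :: 'a topology)"
    and R: "right_haar_measure \<rho>" and \<alpha>: "top_automorphism \<alpha>"
  shows "scales_measure \<rho> \<alpha> (modular_hom \<rho> \<alpha>)"
proof -
  interpret R: right_haar \<rho> by unfold_locales fact
  obtain c where c: "0 < c" "distr \<rho> borel \<alpha> = scale_measure (ennreal c) \<rho>"
    using Haar_measure_unique[OF lc R right_haar_measure_distr_automorphism[OF R \<alpha>]] by blast
  have "\<exists>K. compact K \<and> emeasure \<rho> K \<noteq> 0"
  proof (rule ccontr)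
    assume "\<not> ?thesis"
    then have "emeasure \<rho> UNIV \<le> 0"
      unfolding R.emeasure_open_inner[OF open_UNIV] by (intro SUP_least) auto
    then show False
      using R.emeasure_UNIV_nonzero by simp
  qed
  then obtain K where K: "compact K" "emeasure \<rho> K \<noteq> 0"
    by blast
  have "c' = c" if "0 < c'" "distr \<rho> borel \<alpha> = scale_measure (ennreal c') \<rho>" for c'
  proof -
    have "emeasure (scale_measure (ennreal c') \<rho>) K = emeasure (scale_measure (ennreal c) \<rho>) K"
      using that(2) c(2) by simp
    moreover obtain m where "emeasure \<rho> K = ennreal m" "0 < m"
      using R.emeasure_compact[OF K(1)] K(2) by (cases "emeasure \<rho> K") (auto simp: less_le)
    ultimately show ?thesis
      using that(1) c(1) by (simp flip: ennreal_mult)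
  qed
  then have "\<exists>!c. 0 < c \<and> distr \<rho> borel \<alpha> = scale_measure (ennreal c) \<rho>"
    using c by blast
  from theI'[OF this] show ?thesis
    using \<alpha> by (simp add: scales_measure_def modular_hom_def)
qed

lemma distr_scale_measure:
  assumes "f \<in> measurable M N"
  shows "distr (scale_measure r M) N f = scale_measure r (distr M N f)"
proof (rule measure_eqI)
  fix A assume "A \<in> sets (distr (scale_measure r M) N f)"
  moreover have "f \<in> measurable (scale_measure r M) N"
    using assms by (simp add: measurable_cong_sets[OF sets_scale_measure refl])
  ultimately show "emeasure (distr (scale_measure r M) N f) A = emeasure (scale_measure r (distr M N f)) A"
    using assms by (simp add: emeasure_distr space_scale_measure)
qed simp

lemma scales_measure_comp:
  fixes \<rho> :: "'a::{topological_group_add,t2_space} measure"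
  assumes sets: "sets \<rho> = sets borel" and a: "scales_measure \<rho> \<alpha> c" and b: "scales_measure \<rho> \<beta> d"
  shows "scales_measure \<rho> (\<alpha> \<circ> \<beta>) (c * d)"
proof -
  note [measurable] = scales_measureD(4)[OF a] scales_measureD(4)[OF b]
  note [measurable_cong] = sets
  have "distr \<rho> borel (\<alpha> \<circ> \<beta>) = distr (distr \<rho> borel \<beta>) borel \<alpha>"
    by (simp add: distr_distr)
  also have "\<dots> = scale_measure (ennreal d) (distr \<rho> borel \<alpha>)"
    unfolding scales_measureD(3)[OF b] by (rule distr_scale_measure) measurable
  also have "\<dots> = scale_measure (ennreal (c * d)) \<rho>"
    using scales_measureD(2)[OF a] scales_measureD(2)[OF b]
    by (simp add: scales_measureD(3)[OF a] mult.commute flip: ennreal_mult)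
  finally show ?thesis
    using scales_measureD[OF a] scales_measureD[OF b]
    by (simp add: scales_measure_def top_automorphism_comp)
qed

lemma scales_measure_inv:
  fixes \<rho> :: "'a::{topological_group_add,t2_space} measure"
  assumes sets: "sets \<rho> = sets borel" and a: "scales_measure \<rho> \<alpha> c"
  shows "scales_measure \<rho> (inv \<alpha>) (inverse c)"
proof -
  note A = scales_measureD[OF a]
  have inv: "top_automorphism (inv \<alpha>)"
    by (rule top_automorphism_inv[OF A(1)])
  have bij: "bij \<alpha>"
    using A(1) by (rule top_automorphismD)
  have "continuous_on UNIV (inv \<alpha>)"
    using inv by (rule top_automorphismD)
  then have [measurable]: "inv \<alpha> \<in> borel_measurable borel"
    by (rule borel_measurable_continuous_onI)
  note [measurable] = A(4)
  note [measurable_cong] = sets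
  have "distr \<rho> borel (\<lambda>x. x) = \<rho>"
    by (rule distr_id2[OF sets[symmetric]])
  then have "\<rho> = distr \<rho> borel (inv \<alpha> \<circ> \<alpha>)"
    using bij by (simp add: bij_is_inj id_def)
  also have "\<dots> = distr (distr \<rho> borel \<alpha>) borel (inv \<alpha>)"
    by (simp add: distr_distr)
  also have "\<dots> = scale_measure (ennreal c) (distr \<rho> borel (inv \<alpha>))"
    unfolding A(3) by (rule distr_scale_measure) measurable
  finally have "scale_measure (ennreal (inverse c)) \<rho> =
      scale_measure (ennreal (inverse c)) (scale_measure (ennreal c) (distr \<rho> borel (inv \<alpha>)))"
    by simp
  also have "\<dots> = distr \<rho> borel (inv \<alpha>)"
    using A(2) by (simp flip: ennreal_mult)
  finally show ?thesis
    using A(2) inv by (simp add: scales_measure_def)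
qed

lemma scales_measure_funpow:
  fixes \<rho> :: "'a::{topological_group_add,t2_space} measure"
  assumes sets: "sets \<rho> = sets borel" and a: "scales_measure \<rho> \<alpha> c"
  shows "scales_measure \<rho> (\<alpha> ^^ k) (c ^ k)"
proof (induction k)
  case 0
  have "top_automorphism (id :: 'a \<Rightarrow> 'a)"
    by (simp add: top_automorphism_def)
  moreover have "distr \<rho> borel id = \<rho>"
    using distr_id2[OF sets[symmetric]] by (simp add: id_def)
  ultimately show ?case
    by (simp add: scales_measure_def id_def)
next
  case (Suc k)
  then show ?case
    unfolding funpow.simps power_Suc by (intro scales_measure_comp[OF sets a])
qed

lemma scales_measure_aut_power:
  fixes \<rho> :: "'a::{topological_group_add,t2_space} measure"
  assumes sets: "sets \<rho> = sets borel" and a: "scales_measure \<rho> \<alpha> c"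
  shows "scales_measure \<rho> (aut_power \<alpha> n) (c powi n)"
  using scales_measure_funpow[OF sets a] scales_measure_funpow[OF sets scales_measure_inv[OF sets a]]
  by (simp add: aut_power_def power_int_def)

lemma aut_power_uminus:
  assumes "bij \<alpha>"
  shows "aut_power \<alpha> (- n) = inv (aut_power \<alpha> n)"
proof (cases "n = 0")
  case False
  have "bij (\<alpha> ^^ k)" for k
    using assms by (simp add: bij_betw_funpow)
  then have "inv (inv \<alpha> ^^ k) = \<alpha> ^^ k" for k
    by (simp add: inv_inv_eq flip: inv_fn[OF assms])
  then show ?thesis
    using False inv_fn[OF assms] by (auto simp: aut_power_def)
qed (simp add: aut_power_def)

lemma nn_integral_scales_measure:
  assumes sets: "sets \<rho> = sets borel" and a: "scales_measure \<rho> \<alpha> c"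
    and h: "h \<in> borel_measurable borel"
  shows "(\<integral>\<^sup>+x. h (\<alpha> x) \<partial>\<rho>) = ennreal c * (\<integral>\<^sup>+x. h x \<partial>\<rho>)"
proof -
  note A = scales_measureD[OF a]
  have "(\<integral>\<^sup>+x. h (\<alpha> x) \<partial>\<rho>) = (\<integral>\<^sup>+x. h x \<partial>distr \<rho> borel \<alpha>)"
    using A(4) h by (subst nn_integral_distr) (auto simp: measurable_cong_sets[OF sets refl])
  also have "\<dots> = ennreal c * (\<integral>\<^sup>+x. h x \<partial>\<rho>)"
    unfolding A(3) by (rule nn_integral_scale_measure) (simp add: h measurable_cong_sets[OF sets refl])
  finally show ?thesis .
qed

lemma integral_scales_measure:
  fixes h :: "'a::{topological_group_add,t2_space} \<Rightarrow> real"
  assumes sets: "sets \<rho> = sets borel" and a: "scales_measure \<rho> \<alpha> c"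
    and h: "h \<in> borel_measurable borel"
  shows "(\<integral>x. h (\<alpha> x) \<partial>\<rho>) = c * (\<integral>x. h x \<partial>\<rho>)"
proof -
  note A = scales_measureD[OF a]
  have "scale_measure (ennreal c) \<rho> = density \<rho> (\<lambda>_. ennreal c)"
    by (rule measure_eqI) (auto simp: emeasure_density_const)
  then have "(\<integral>x. h x \<partial>distr \<rho> borel \<alpha>) = (\<integral>x. c *\<^sub>R h x \<partial>\<rho>)"
    unfolding A(3) using A(2) h
    by (simp only:) (subst integral_density, auto simp: measurable_cong_sets[OF sets refl])
  then show ?thesis
    using A(4) h by (subst (asm) integral_distr) (auto simp: measurable_cong_sets[OF sets refl])
qed

section \<open>Property RD bounds the modular constant\<close>

lemma ennreal_powr_mono:
  assumes "x \<le> y" "0 \<le> s"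
  shows "ennreal_powr x s \<le> ennreal_powr y s"
proof (cases "y = \<infinity>")
  case False
  then have "x \<noteq> \<infinity>"
    using assms(1) by (auto simp: top_unique)
  then show ?thesis
    using False assms by (auto simp: ennreal_powr_def top.not_eq_extremum intro!: ennreal_leI powr_mono2 enn2real_mono)
qed (simp add: ennreal_powr_def)

lemma ennreal_powr_ennreal: "0 \<le> r \<Longrightarrow> ennreal_powr (ennreal r) s = ennreal (r powr s)"
  by (simp add: ennreal_powr_def)

lemma L2_norm_of_real:
  assumes "(\<integral>\<^sup>+x. ennreal ((f x)\<^sup>2) \<partial>\<rho>) = ennreal r" "0 \<le> r"
  shows "L2_norm \<rho> (\<lambda>x. complex_of_real (f x)) = ennreal (sqrt r)"
  using assms by (simp add: L2_norm_def ennreal_powr_ennreal powr_half_sqrt)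

text \<open>
  The constant \<open>D\<close> is uniform over all automorphisms \<open>\<beta>\<close> that scale \<open>\<rho>\<close>; the powers of a
  single automorphism are a special case.
\<close>

lemma modulus_le_of_property_RD:
  fixes \<rho> :: "'a::{topological_group_add,t2_space} measure"
  assumes lc: "locally_compact_space (euclidean :: 'a topology)"
    and R: "right_haar_measure \<rho>" and RD: "property_RD \<rho> l s"
    and U: "open U" "U \<noteq> {}"
  shows "\<exists>D>0. \<forall>\<beta> d. scales_measure \<rho> \<beta> d \<longrightarrow>
           ennreal d \<le> ennreal D * ennreal_powr (1 + set_length l (\<beta> -` U)) (2 * s)"
proof -
  interpret R: right_haar \<rho> by unfold_locales fact
  note sets = R.sets_eq_borel
  obtain C where s: "0 < s" and C: "0 < C" "\<And>f. compactly_supported_continuous f \<Longrightarrow>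
      op_norm \<rho> f \<le> ennreal C * ennreal_powr (1 + fun_length l f) s * L2_norm \<rho> f"
    using RD by (auto simp: property_RD_def)
  obtain u where u: "u \<in> U" using U by auto
  obtain f where f: "Cc f" "\<And>x. 0 \<le> f x" "f u = 1" "\<And>x. x \<notin> U \<Longrightarrow> f x = 0"
    by (rule Cc_Urysohn[OF lc, of "{u}" U]) (use U u in auto)
  obtain K where K: "compact K" "\<And>x. x \<notin> K \<Longrightarrow> f x = 0"
    using f(1) by (auto simp: Cc_def)
  note contf = continuous_on_comp_UNIV[OF Cc_continuous[OF f(1)]]
  have [measurable]: "f \<in> borel_measurable borel"
    by (rule Cc_measurable[OF f(1)])
  define a where "a = (\<integral>x. (f x)\<^sup>2 \<partial>\<rho>)"
  have f2: "Cc (\<lambda>x. (f x)\<^sup>2)"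
    using Cc_mult[OF f(1) Cc_continuous[OF f(1)]] by (simp add: power2_eq_square)
  have a: "0 < a" "(\<integral>\<^sup>+x. ennreal ((f x)\<^sup>2) \<partial>\<rho>) = ennreal a"
    unfolding a_def using f(3) R.integral_Cc_pos[OF f2, of u] R.integrable_Cc[OF f2]
    by (auto intro!: nn_integral_eq_integral)
  define T where "T x = (\<integral>y. f (- y) * f (y + x) \<partial>\<rho>)" for x
  have contT: "continuous_on UNIV T"
    unfolding T_def[abs_def]
  proof (rule R.continuous_on_parametric_integral)
    show "continuous_on UNIV (\<lambda>(x, y). f (- y) * f (y + x))"
      unfolding case_prod_beta' by (intro continuous_intros contf)
    show "compact (uminus ` K)"
      by (intro compact_continuous_image K continuous_intros)
    show "f (- y) * f (y + x) = 0" if "y \<notin> uminus ` K" for x y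
      using that K(2)[of "- y"] by (metis image_eqI minus_minus mult_zero_left)
  qed
  then have [measurable]: "T \<in> borel_measurable borel"
    by (rule borel_measurable_continuous_onI)
  have Cc_T: "Cc (\<lambda>y. f (- y) * f (y + x))" for x
    by (intro Cc_mult Cc_uminus f(1) contf continuous_intros)
  \<comment> \<open>At \<open>y = - u\<close> both \<open>f (- y)\<close> and \<open>f (y + (u + u))\<close> equal \<open>f u = 1\<close>.\<close>
  have "0 < T (u + u)"
    unfolding T_def using f(2,3)
    by (intro R.integral_Cc_pos[OF Cc_T, of _ "- u"]) (auto simp: add.assoc[symmetric])
  define b where "b = (\<integral>\<^sup>+x. ennreal ((T x)\<^sup>2) \<partial>\<rho>)"
  have "b \<noteq> 0"
  proof -
    have opn: "open {x. T x \<noteq> 0}"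
      using contT by (intro open_Collect_neq) auto
    then have "emeasure \<rho> {x. T x \<noteq> 0} \<noteq> 0"
      using \<open>0 < T (u + u)\<close> by (intro R.emeasure_open_nonzero) (auto intro: exI[of _ "u + u"])
    then have "\<not> (AE x in \<rho>. T x = 0)"
      using opn by (subst AE_iff_measurable[of "{x. T x \<noteq> 0}"]) auto
    then show ?thesis
      by (simp add: b_def nn_integral_0_iff_AE)
  qed
  \<comment> \<open>A finite lower bound avoids proving that \<open>T\<close> is square integrable.\<close>
  then obtain b0 where b0: "0 < b0" "ennreal b0 \<le> b"
  proof (cases b)
    case (real r)
    then show ?thesis
      using \<open>b \<noteq> 0\<close> that[of r] by (auto simp: less_le)
  qed (auto intro: that[of 1])
  define D where "D = C\<^sup>2 * a\<^sup>2 / b0"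
  have "0 < D"
    using C(1) a(1) b0(1) by (simp add: D_def)
  moreover have "ennreal d \<le> ennreal D * ennreal_powr (1 + set_length l (\<beta> -` U)) (2 * s)"
    if \<beta>: "scales_measure \<rho> \<beta> d" for \<beta> d
  proof (cases "set_length l (\<beta> -` U) = \<infinity>")
    case True
    then show ?thesis
      using \<open>0 < D\<close> by (simp add: ennreal_powr_def ennreal_mult_top)
  next
    case False
    note B = scales_measureD[OF \<beta>]
    note contB = top_automorphismD(1,2)[OF B(1)] and bijB = top_automorphismD(3)[OF B(1)]
      and addB = top_automorphismD(4)[OF B(1)]
    note [measurable] = B(4)
    have d: "0 < d" by (rule B)
    \<comment> \<open>\<open>q\<close> is the \<open>L\<^sup>2\<close> norm of \<open>f \<circ> \<beta>\<close>, so \<open>g\<close> is a unit vector.\<close>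
    define q where "q = sqrt (d * a)"
    have q: "0 < q" "q\<^sup>2 = d * a"
      using d a(1) by (auto simp: q_def)
    define f\<^sub>\<beta> where "f\<^sub>\<beta> x = complex_of_real (f (\<beta> x))" for x
    define g where "g x = complex_of_real (f (\<beta> x) / q)" for x
    have norm_f: "L2_norm \<rho> f\<^sub>\<beta> = ennreal q"
      unfolding f\<^sub>\<beta>_def[abs_def] q_def using d a
      by (intro L2_norm_of_real)
         (auto simp: nn_integral_scales_measure[OF sets \<beta>, where h="\<lambda>x. ennreal ((f x)\<^sup>2)"] ennreal_mult)
    have "(\<integral>\<^sup>+x. ennreal ((f (\<beta> x) / q)\<^sup>2) \<partial>\<rho>) = ennreal (1 / q\<^sup>2) * (\<integral>\<^sup>+x. ennreal ((f (\<beta> x))\<^sup>2) \<partial>\<rho>)"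
      by (subst nn_integral_cmult[symmetric]) (auto simp: power_divide simp flip: ennreal_mult)
    also have "\<dots> = ennreal 1"
      using d a q by (simp add: nn_integral_scales_measure[OF sets \<beta>, where h="\<lambda>x. ennreal ((f x)\<^sup>2)"]
          flip: ennreal_mult)
    finally have norm_g: "L2_norm \<rho> g = 1"
      unfolding g_def[abs_def] by (subst L2_norm_of_real) auto
    have conv: "conv_operator \<rho> f\<^sub>\<beta> g x = complex_of_real (d / q * T (\<beta> x))" for x
    proof -
      have "conv_operator \<rho> f\<^sub>\<beta> g x = (\<integral>y. complex_of_real (f (- \<beta> y) * f (\<beta> y + \<beta> x) / q) \<partial>\<rho>)"
        by (simp add: conv_operator_def f\<^sub>\<beta>_def g_def addB top_automorphism_uminus[OF B(1)])
      also have "\<dots> = complex_of_real ((\<integral>y. f (- \<beta> y) * f (\<beta> y + \<beta> x) \<partial>\<rho>) / q)"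
        by (simp only: integral_complex_of_real integral_divide_zero)
      also have "(\<integral>y. f (- \<beta> y) * f (\<beta> y + \<beta> x) \<partial>\<rho>) = d * T (\<beta> x)"
        unfolding T_def by (rule integral_scales_measure[OF sets \<beta> Cc_measurable[OF Cc_T]])
      finally show ?thesis by simp
    qed
    have "ennreal (d\<^sup>2 * b0 / a) = ennreal (d / a) * (ennreal d * ennreal b0)"
      using d a b0 by (simp add: power2_eq_square flip: ennreal_mult)
    also have "\<dots> \<le> ennreal (d / a) * (ennreal d * b)"
      by (intro mult_left_mono b0) auto
    also have "\<dots> = ennreal (d / a) * (\<integral>\<^sup>+x. ennreal ((T (\<beta> x))\<^sup>2) \<partial>\<rho>)"
      by (simp add: b_def nn_integral_scales_measure[OF sets \<beta>, where h="\<lambda>x. ennreal ((T x)\<^sup>2)"])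
    also have "\<dots> = (\<integral>\<^sup>+x. ennreal ((cmod (conv_operator \<rho> f\<^sub>\<beta> g x))\<^sup>2) \<partial>\<rho>)"
      using d a q by (subst nn_integral_cmult[symmetric])
        (auto simp: conv norm_mult norm_divide power_mult_distrib power_divide power2_eq_square[of d] simp flip: ennreal_mult)
    finally have "ennreal_powr (ennreal (d\<^sup>2 * b0 / a)) (1/2) \<le> L2_norm \<rho> (conv_operator \<rho> f\<^sub>\<beta> g)"
      unfolding L2_norm_def by (intro ennreal_powr_mono) auto
    then have "ennreal (sqrt (d\<^sup>2 * b0 / a)) \<le> L2_norm \<rho> (conv_operator \<rho> f\<^sub>\<beta> g)"
      using d a b0 by (simp add: ennreal_powr_ennreal powr_half_sqrt)
    also have "\<dots> \<le> op_norm \<rho> f\<^sub>\<beta>"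
      unfolding op_norm_def using norm_g by (intro SUP_upper) (auto simp: g_def[abs_def])
    also have "\<dots> \<le> ennreal C * ennreal_powr (1 + fun_length l f\<^sub>\<beta>) s * L2_norm \<rho> f\<^sub>\<beta>"
    proof (rule C(2))
      have "\<beta> -` K = inv \<beta> ` K"
        using bijB by (rule bij_vimage_eq_inv_image)
      then have "compact (\<beta> -` K)"
        using K(1) contB(2) by (metis compact_continuous_image continuous_on_subset subset_UNIV)
      moreover have "closure {x. f\<^sub>\<beta> x \<noteq> 0} \<subseteq> \<beta> -` K"
        using calculation K(2) by (intro closure_minimal compact_imp_closed) (auto simp: f\<^sub>\<beta>_def)
      ultimately have "compact (closure {x. f\<^sub>\<beta> x \<noteq> 0})"
        using compact_Int_closed[of "\<beta> -` K" "closure {x. f\<^sub>\<beta> x \<noteq> 0}"] by (simp add: Int_absorb1)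
      then show "compactly_supported_continuous f\<^sub>\<beta>"
        unfolding compactly_supported_continuous_def f\<^sub>\<beta>_def[abs_def]
        by (intro conjI continuous_intros contf contB)
    qed
    also have "\<dots> \<le> ennreal C * ennreal_powr (1 + set_length l (\<beta> -` U)) s * ennreal q"
    proof -
      have "fun_length l f\<^sub>\<beta> \<le> set_length l (\<beta> -` U)"
        unfolding fun_length_def set_length_def using f(4) by (intro SUP_subset_mono) (auto simp: f\<^sub>\<beta>_def)
      then show ?thesis
        unfolding norm_f using s by (intro mult_right_mono mult_left_mono ennreal_powr_mono add_left_mono) auto
    qed
    finally have le: "ennreal (sqrt (d\<^sup>2 * b0 / a))
        \<le> ennreal C * ennreal_powr (1 + set_length l (\<beta> -` U)) s * ennreal q" .
    define r where "r = 1 + enn2real (set_length l (\<beta> -` U))"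
    have r: "0 < r" "1 + set_length l (\<beta> -` U) = ennreal r"
      using False by (auto simp: r_def ennreal_plus top.not_eq_extremum add_pos_nonneg)
    have "sqrt (d\<^sup>2 * b0 / a) \<le> C * r powr s * q"
      using le r C(1) q(1) by (simp add: ennreal_powr_ennreal flip: ennreal_mult)
    then have "(sqrt (d\<^sup>2 * b0 / a))\<^sup>2 \<le> (C * r powr s * q)\<^sup>2"
      using d a b0 by (intro power_mono) auto
    then have "d\<^sup>2 * b0 / a \<le> C\<^sup>2 * r powr (2 * s) * (d * a)"
      using d a b0 r by (simp add: power_mult_distrib q(2) powr_power mult_ac)
    then have "d \<le> D * r powr (2 * s)"
      using d a b0 by (simp add: D_def field_simps power2_eq_square)
    then show ?thesis
      using r \<open>0 < D\<close> by (simp add: ennreal_powr_ennreal flip: ennreal_mult)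
  qed
  ultimately show ?thesis by blast
qed

theorem theorem3p1:
  fixes \<rho> :: "'a::{topological_group_add,t2_space} measure"
    and l :: "'a \<Rightarrow> real" and s :: real
    and \<alpha> :: "'a \<Rightarrow> 'a" and U :: "'a set"
  assumes "locally_compact_space (euclidean :: 'a topology)"
    and "right_haar_measure \<rho>"
    and "group_length l"
    and "property_RD \<rho> l s"
    and "top_automorphism \<alpha>"
    and "open U" and "U \<noteq> {}" and "compact (closure U)"
  shows "\<exists>D::real. 0 < D \<and>
           (\<forall>n::int. ennreal (modular_hom \<rho> \<alpha> powi n)
              \<le> ennreal D * ennreal_powr (1 + set_length l (aut_power \<alpha> (- n) ` U)) (2 * s))"
proof -
  obtain D where D: "0 < D" "\<And>\<beta> d. scales_measure \<rho> \<beta> d \<Longrightarrow>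
      ennreal d \<le> ennreal D * ennreal_powr (1 + set_length l (\<beta> -` U)) (2 * s)"
    using modulus_le_of_property_RD[OF assms(1,2,4,6,7)] by blast
  have sets: "sets \<rho> = sets borel"
    using assms(2) by (auto simp only: right_haar_measure_def)
  have scales: "scales_measure \<rho> (aut_power \<alpha> n) (modular_hom \<rho> \<alpha> powi n)" for n
    by (rule scales_measure_aut_power[OF sets scales_measure_modular_hom[OF assms(1,2,5)]])
  have "aut_power \<alpha> (- n) ` U = aut_power \<alpha> n -` U" for n
  proof -
    have "bij (aut_power \<alpha> n)"
      using scales_measureD(1)[OF scales] by (rule top_automorphismD)
    moreover have "bij \<alpha>"
      using assms(5) by (rule top_automorphismD)
    ultimately show ?thesis
      by (simp add: aut_power_uminus bij_vimage_eq_inv_image)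
  qed
  then show ?thesis
    using D(1) D(2)[OF scales] by auto
qed

end
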